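(* Let $d$ be a positive integer and let $(a_n)_{n\ge1}$ be a sequence in $\mathbb{R}^d$ with $\|a_n\|\to0$ which has $d$ linearly independent Lévy vectors. Then $S(a_n)=\mathbb{R}^d$, i.e. for every $x\in\mathbb{R}^d$ there is a sign sequence $(\varepsilon_n)_{n\ge1}\in\{-1,1\}^{\mathbb{N}}$ such that $\sum_{n=1}^\infty \varepsilon_n a_n = x$.
   Context: $\|\cdot\|$ is the Euclidean norm on $\mathbb{R}^d$, $\mathbb{S}^{d-1}$ is the unit sphere of $\mathbb{R}^d$, and $B(u,r)$ is the open ball of center $u$ and radius $r$. For a sequence $(a_n)$ in $\mathbb{R}^d$, $S(a_n)$ denotes the set of all $x\in\mathbb{R}^d$ for which there is $\varepsilon\in\{-1,1\}^{\mathbb{N}}$ such that the partial sums of $\sum_{n=1}^\infty\varepsilon_n a_n$ converge to $x$. A vector $u\in\mathbb{S}^{d-1}$ is a Lévy vector of a sequence $(a_n)$ in $\mathbb{R}^d$ tending to $0$ if for every $\varepsilon>0$, $$\sum_{n=1}^\infty \|a_n\|\,\chi\!\left(\frac{a_n}{\|a_n\|}\in B(u,\varepsilon)\right)=\infty,$$ where $\chi(E)=1$ if the condition $E$ holds and $\chi(E)=0$ otherwise (terms with $a_n=0$ contribute $0$). *)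

theory Defs
  imports "HOL-Analysis.Analysis"
begin

text \<open>
  Sequences are indexed from \<open>0\<close>, so \<open>a n\<close> is the (n+1)-st term.
  The sums are ordered: \<open>sums\<close> is convergence of the partial sums.
\<close>

definition sign_sums :: "(nat \<Rightarrow> real ^ 'd) \<Rightarrow> (real ^ 'd) set" where
  "sign_sums a =
     {x. \<exists>\<epsilon> :: nat \<Rightarrow> real. (\<forall>n. \<epsilon> n \<in> {-1, 1}) \<and> (\<lambda>n. \<epsilon> n *\<^sub>R a n) sums x}"

text \<open>
  The series has nonnegative terms and is evaluated in \<open>ennreal\<close>, so that its sum may be
  \<open>\<infinity>\<close>. If \<open>a n = 0\<close>, the normalised vector is \<open>0\<close> by the
  convention \<open>inverse 0 = 0\<close>; the term vanishes anyway because of the factor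
  \<open>norm (a n)\<close>. That \<open>a\<close> tends to \<open>0\<close> is not part of the
  definition and has to be assumed where the notion is used.
\<close>

definition levy_vector :: "(nat \<Rightarrow> real ^ 'd) \<Rightarrow> real ^ 'd \<Rightarrow> bool" where
  "levy_vector a u \<longleftrightarrow>
     u \<in> sphere 0 1 \<and>
     (\<forall>\<epsilon>>0. (\<Sum>n. ennreal (norm (a n) * of_bool (a n /\<^sub>R norm (a n) \<in> ball u \<epsilon>))) = \<infinity>)"

end

theory Submission
  imports Defs
begin

text \<open>
  Assign consecutive blocks of indices to the Levy vectors, each infinitely often, and in the
  \<open>k\<close>-th block select terms with direction within \<open>2\<^sup>-\<^sup>k\<close> of the assigned vector \<open>u\<close> and with
  total norm about \<open>1\<close>. Up to an absolutely summable error, a selected term is then a positive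
  multiple of its vector \<open>u\<close>, and for each \<open>u\<close> these multiples tend to \<open>0\<close> with infinite sum. The
  remaining terms tend to \<open>0\<close>, so by the Barany--Grinberg argument they can be signed so as to form
  a convergent series (after division by a decreasing null majorant of the norms, whose effect the
  Dirichlet test undoes). What is left of the target is reached by the selected terms: at each of them
  the sign is that of the coordinate of the current residual along \<open>u\<close>, which drives every
  coordinate of the residual to \<open>0\<close>, whatever the signs of the summable errors.
\<close>

section \<open>Signing bounded vectors with bounded partial sums\<close>

text \<open>Stated for an indexed family, since vectors of a sequence may repeat: if
  \<open>v\<close> is injective on \<open>F\<close>, the image is too large to be independent, and
  otherwise two equal vectors cancel.\<close>

lemma card_gt_DIM_imp_linear_relation:
  fixes v :: "'i \<Rightarrow> 'a::euclidean_space"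
  assumes "finite F" and "DIM('a) < card F"
  obtains c where "\<exists>i\<in>F. c i \<noteq> (0::real)" and "(\<Sum>i\<in>F. c i *\<^sub>R v i) = 0"
proof (cases "inj_on v F")
  case True
  then have "dependent (v ` F)"
    using assms by (metis card_image independent_card_le not_less)
  then obtain u where u: "\<exists>x\<in>v ` F. u x \<noteq> 0" "(\<Sum>x\<in>v ` F. u x *\<^sub>R x) = 0"
    using assms(1) by (auto simp: dependent_finite)
  show thesis
    by (rule that[of "u \<circ> v"]) (use u True in \<open>auto simp: sum.reindex\<close>)
next
  case False
  then obtain i j where ij: "i \<in> F" "j \<in> F" "i \<noteq> j" "v i = v j"
    by (auto simp: inj_on_def)
  define c :: "'i \<Rightarrow> real" where "c k = of_bool (k = i) - of_bool (k = j)" for k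
  have "(\<Sum>k\<in>F. c k *\<^sub>R v k) = (\<Sum>k\<in>F. if k = i then v k else 0) - (\<Sum>k\<in>F. if k = j then v k else 0)"
    unfolding sum_subtractf[symmetric] by (rule sum.cong) (auto simp: c_def)
  also have "\<dots> = 0"
    using ij assms(1) by simp
  finally show thesis
    by (intro that[of c]) (use ij in \<open>auto simp: c_def\<close>)
qed

text \<open>Starting inside the open cube, follow the direction \<open>c\<close> up to the first
  moment \<open>s\<close> at which some coordinate meets a face.\<close>

lemma move_to_cube_boundary:
  fixes x c :: "'i \<Rightarrow> real"
  assumes "finite F" and int: "\<And>i. i \<in> F \<Longrightarrow> \<bar>x i\<bar> < 1" and "\<exists>i\<in>F. c i \<noteq> 0"
  obtains s where "\<And>i. i \<in> F \<Longrightarrow> \<bar>x i + s * c i\<bar> \<le> 1" and "\<exists>i\<in>F. \<bar>x i + s * c i\<bar> = 1"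
proof -
  define G where "G = {i\<in>F. c i \<noteq> 0}"
  \<comment> \<open>\<open>h i\<close> solves \<open>x i + h i * c i = sgn (c i)\<close>: it is the
    time at which coordinate \<open>i\<close> arrives at the face it is heading for.\<close>
  define h where "h i = (1 - sgn (c i) * x i) / \<bar>c i\<bar>" for i
  have G: "finite G" "G \<noteq> {}"
    using assms by (auto simp: G_def)
  define s where "s = Min (h ` G)"
  have "s \<in> h ` G"
    unfolding s_def using G by (intro Min_in) auto
  then obtain j where j: "j \<in> G" "s = h j" by auto
  have h_pos: "0 < h i" if "i \<in> G" for i
    using int[of i] that unfolding h_def G_def
    by (intro divide_pos_pos) (auto simp: sgn_if)
  have s_le: "s \<le> h i" if "i \<in> G" for i
    using G that by (auto simp: s_def)
  have le: "\<bar>x i + s * c i\<bar> \<le> 1" if "i \<in> F" for i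
  proof (cases "c i = 0")
    case True
    then show ?thesis using int[OF that] by simp
  next
    case False
    then have "i \<in> G" using that by (simp add: G_def)
    from s_le[OF this] False have *: "s * \<bar>c i\<bar> \<le> 1 - sgn (c i) * x i"
      by (simp add: h_def pos_le_divide_eq)
    have "0 \<le> s * \<bar>c i\<bar>" using h_pos[OF j(1)] j(2) by simp
    then show ?thesis
      using * int[OF that] False by (cases "c i > 0") (auto simp: sgn_if)
  qed
  have "s * \<bar>c j\<bar> = 1 - sgn (c j) * x j"
    using j by (simp add: h_def G_def)
  then have "\<bar>x j + s * c j\<bar> = 1"
    using j by (cases "c j > 0") (auto simp: sgn_if G_def)
  then show thesis
    using that[of s] le j by (auto simp: G_def)
qed

text \<open>In the Barany--Grinberg process the vectors arrive one by one with coefficient \<open>0\<close>. As soon as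
  more than \<open>DIM('a)\<close> coefficients lie strictly between \<open>-1\<close> and \<open>1\<close>, a linear relation among their
  vectors allows moving them, without changing the weighted sum \<open>0\<close>, until one of them reaches
  \<open>\<plusminus>1\<close>, where it stays forever. The final signs thus differ from the coefficients at any time
  in at most \<open>DIM('a)\<close> places, by at most \<open>2\<close> each.\<close>

definition floating :: "nat \<Rightarrow> (nat \<Rightarrow> real) \<Rightarrow> nat set" where
  "floating k x = {i. i < k \<and> \<bar>x i\<bar> < 1}"

definition partial_signing :: "(nat \<Rightarrow> 'a::euclidean_space) \<Rightarrow> nat \<Rightarrow> (nat \<Rightarrow> real) \<Rightarrow> bool" where
  "partial_signing v k x \<longleftrightarrow>
     (\<forall>i. \<bar>x i\<bar> \<le> 1) \<and> (\<forall>i\<ge>k. x i = 0) \<and> (\<Sum>i<k. x i *\<^sub>R v i) = 0 \<and>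
     card (floating k x) \<le> DIM('a)"

lemma partial_signing_step:
  fixes v :: "nat \<Rightarrow> 'a::euclidean_space"
  assumes "partial_signing v k x"
  shows "\<exists>y. partial_signing v (Suc k) y \<and> (\<forall>i. \<bar>x i\<bar> = 1 \<longrightarrow> y i = x i)"
proof -
  have x: "\<And>i. \<bar>x i\<bar> \<le> 1" "\<And>i. k \<le> i \<Longrightarrow> x i = 0" "(\<Sum>i<k. x i *\<^sub>R v i) = 0"
    "card (floating k x) \<le> DIM('a)"
    using assms by (auto simp: partial_signing_def)
  \<comment> \<open>Index \<open>k\<close> has just arrived with coefficient \<open>0\<close>, so it
    floats as well.\<close>
  define F where "F = floating (Suc k) x"
  have F: "finite F" "F \<subseteq> {..<Suc k}" "F = insert k (floating k x)"
    using x(2)[of k] by (auto simp: F_def floating_def less_Suc_eq)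
  have fin: "finite (floating k x)" by (simp add: floating_def)
  have sum_x: "(\<Sum>i<Suc k. x i *\<^sub>R v i) = 0"
    using x(2,3) by simp
  show ?thesis
  proof (cases "card F \<le> DIM('a)")
    case True
    then have "partial_signing v (Suc k) x"
      unfolding partial_signing_def using x sum_x by (auto simp: F_def)
    then show ?thesis by auto
  next
    case False
    then have "DIM('a) < card F" by simp
    then obtain c where c: "\<exists>i\<in>F. c i \<noteq> 0" "(\<Sum>i\<in>F. c i *\<^sub>R v i) = 0"
      using card_gt_DIM_imp_linear_relation[OF F(1)] by metis
    have int: "\<bar>x i\<bar> < 1" if "i \<in> F" for i
      using that by (auto simp: F_def floating_def)
    obtain s where s: "\<And>i. i \<in> F \<Longrightarrow> \<bar>x i + s * c i\<bar> \<le> 1" "\<exists>i\<in>F. \<bar>x i + s * c i\<bar> = 1"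
      by (rule move_to_cube_boundary[OF F(1) int c(1)]) auto
    define y where "y i = (if i \<in> F then x i + s * c i else x i)" for i
    have "(\<Sum>i<Suc k. y i *\<^sub>R v i) = (\<Sum>i<Suc k. x i *\<^sub>R v i) + (\<Sum>i<Suc k. if i \<in> F then s *\<^sub>R c i *\<^sub>R v i else 0)"
      unfolding sum.distrib[symmetric] by (rule sum.cong) (auto simp: y_def scaleR_add_left)
    also have "(\<Sum>i<Suc k. if i \<in> F then s *\<^sub>R c i *\<^sub>R v i else 0) = (\<Sum>i\<in>F. s *\<^sub>R c i *\<^sub>R v i)"
      using F by (subst sum.inter_restrict[symmetric]) (auto simp: Int_absorb1)
    also have "\<dots> = 0"
      using c(2) by (simp only: scaleR_sum_right[symmetric] scaleR_zero_right)
    finally have sum_y: "(\<Sum>i<Suc k. y i *\<^sub>R v i) = 0"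
      using sum_x by simp
    have "floating (Suc k) y \<subset> F"
    proof -
      have "floating (Suc k) y \<subseteq> F"
        by (auto simp: F_def floating_def y_def split: if_splits)
      moreover obtain j where "j \<in> F" "\<bar>x j + s * c j\<bar> = 1" using s(2) by auto
      then have "j \<notin> floating (Suc k) y"
        by (auto simp: floating_def y_def)
      ultimately show ?thesis using \<open>j \<in> F\<close> by blast
    qed
    then have "card (floating (Suc k) y) < card F"
      using F(1) by (rule psubset_card_mono[rotated])
    \<comment> \<open>The newcomer raises the number of floating indices by at most one, and the
      move has frozen at least one of them.\<close>
    moreover have "card F \<le> Suc (card (floating k x))"
      unfolding F(3) by (rule card_insert_le_m1) (use fin in auto)
    ultimately have "card (floating (Suc k) y) \<le> DIM('a)"
      using x(4) by linarith
    moreover have "y i = 0" if "Suc k \<le> i" for i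
      using that F(2) x(2)[of i] by (auto simp: y_def)
    ultimately have "partial_signing v (Suc k) y"
      unfolding partial_signing_def using x(1) s(1) sum_y by (auto simp: y_def)
    moreover have "\<forall>i. \<bar>x i\<bar> = 1 \<longrightarrow> y i = x i"
      using int by (metis less_irrefl y_def)
    ultimately show ?thesis by blast
  qed
qed

lemma signs_with_bounded_partial_sums:
  fixes v :: "nat \<Rightarrow> 'a::euclidean_space" and M :: real
  assumes M: "\<And>n. norm (v n) \<le> M"
  obtains \<epsilon> :: "nat \<Rightarrow> real" where "\<And>n. \<epsilon> n \<in> {-1, 1}"
    and "\<And>n. norm (\<Sum>i<n. \<epsilon> i *\<^sub>R v i) \<le> 2 * DIM('a) * M"
proof -
  have "\<exists>X. \<forall>k. partial_signing v k (X k) \<and> (\<forall>i. \<bar>X k i\<bar> = 1 \<longrightarrow> X (Suc k) i = X k i)"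
  proof (rule dependent_nat_choice)
    show "\<exists>x. partial_signing v 0 x"
      by (rule exI[of _ "\<lambda>_. 0"]) (simp add: partial_signing_def floating_def)
  qed (rule partial_signing_step)
  then obtain X where X: "\<And>k. partial_signing v k (X k)"
    and frozen: "\<And>k i. \<bar>X k i\<bar> = 1 \<Longrightarrow> X (Suc k) i = X k i"
    by blast
  have stable: "X l i = X k i" if "\<bar>X k i\<bar> = 1" "k \<le> l" for k l i
    using that(2) by (induction l rule: dec_induct) (use that(1) frozen in auto)
  \<comment> \<open>The value at which coefficient \<open>i\<close> froze. A coefficient that never
    freezes gets the default 1; it is floating at every time after its arrival and is counted
    there.\<close>
  define \<epsilon> where "\<epsilon> i = (if \<exists>k. \<bar>X k i\<bar> = 1 then X (SOME k. \<bar>X k i\<bar> = 1) i else 1)" for i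
  have eps_eq: "\<epsilon> i = X k i" if "\<bar>X k i\<bar> = 1" for i k
  proof -
    define l where "l = (SOME k. \<bar>X k i\<bar> = 1)"
    have l: "\<bar>X l i\<bar> = 1"
      unfolding l_def using that by (rule someI)
    have "\<epsilon> i = X l i"
      using that by (auto simp: \<epsilon>_def l_def)
    also have "\<dots> = X k i"
      using stable[OF l] stable[OF that] by (metis nle_le)
    finally show ?thesis .
  qed
  have eps: "\<epsilon> i \<in> {-1, 1}" for i
  proof (cases "\<exists>k. \<bar>X k i\<bar> = 1")
    case True
    then obtain k where "\<bar>X k i\<bar> = 1" ..
    with eps_eq[OF this] show ?thesis by auto
  qed (simp add: \<epsilon>_def)
  have "norm (\<Sum>i<n. \<epsilon> i *\<^sub>R v i) \<le> 2 * DIM('a) * M" for n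
  proof -
    have Xn: "\<And>i. \<bar>X n i\<bar> \<le> 1" "(\<Sum>i<n. X n i *\<^sub>R v i) = 0" "card (floating n (X n)) \<le> DIM('a)"
      using X[of n] by (auto simp: partial_signing_def)
    have M0: "0 \<le> M" using M[of 0] norm_ge_zero order_trans by blast
    \<comment> \<open>Subtracting the vanishing weighted sum leaves only the indices still floating
      at time \<open>n\<close>.\<close>
    have "(\<Sum>i<n. \<epsilon> i *\<^sub>R v i) = (\<Sum>i<n. (\<epsilon> i - X n i) *\<^sub>R v i)"
      using Xn(2) by (simp add: scaleR_diff_left sum_subtractf)
    also have "\<dots> = (\<Sum>i\<in>floating n (X n). (\<epsilon> i - X n i) *\<^sub>R v i)"
    proof (rule sum.mono_neutral_right)
      show "\<forall>i\<in>{..<n} - floating n (X n). (\<epsilon> i - X n i) *\<^sub>R v i = 0"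
      proof
        fix i assume "i \<in> {..<n} - floating n (X n)"
        then have "\<bar>X n i\<bar> = 1" using Xn(1)[of i] by (auto simp: floating_def)
        then show "(\<epsilon> i - X n i) *\<^sub>R v i = 0" using eps_eq by simp
      qed
    qed (auto simp: floating_def)
    also have "norm \<dots> \<le> card (floating n (X n)) * (2 * M)"
    proof (rule sum_norm_bound)
      fix i
      have "\<bar>\<epsilon> i - X n i\<bar> \<le> 2" using eps[of i] Xn(1)[of i] by auto
      then show "norm ((\<epsilon> i - X n i) *\<^sub>R v i) \<le> 2 * M"
        using M[of i] by (auto intro: mult_mono)
    qed
    also have "\<dots> \<le> DIM('a) * (2 * M)"
      using Xn(3) M0 by (intro mult_right_mono) auto
    finally show ?thesis by (simp add: algebra_simps)
  qed
  with eps that show thesis by blast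
qed

section \<open>From bounded partial sums to convergence\<close>

text \<open>Summation by parts: the boundary term tends to \<open>0\<close>, and the remaining
  series is dominated by \<open>C\<close> times the telescoping differences of
  \<open>l\<close>.\<close>

lemma dirichlet_test:
  fixes w :: "nat \<Rightarrow> 'a::banach" and l :: "nat \<Rightarrow> real"
  assumes l: "decseq l" "l \<longlonglongrightarrow> 0" and C: "\<And>n. norm (\<Sum>i<n. w i) \<le> C"
  shows "summable (\<lambda>i. l i *\<^sub>R w i)"
proof -
  define W where "W n = (\<Sum>i<n. w i)" for n
  have abel: "(\<Sum>i<n. l i *\<^sub>R w i) = l n *\<^sub>R W n + (\<Sum>i<n. (l i - l (Suc i)) *\<^sub>R W (Suc i))" for n
    by (induction n) (simp_all add: W_def algebra_simps)
  have "summable (\<lambda>i. (l i - l (Suc i)) *\<^sub>R W (Suc i))"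
  proof (rule summable_comparison_test')
    show "summable (\<lambda>i. (l i - l (Suc i)) * C)"
      by (intro summable_mult2 telescope_summable'[OF l(2)])
    show "norm ((l i - l (Suc i)) *\<^sub>R W (Suc i)) \<le> (l i - l (Suc i)) * C" for i
      using C[of "Suc i"] decseq_SucD[OF l(1), of i] by (auto simp: W_def intro!: mult_left_mono)
  qed
  moreover have "(\<lambda>n. l n *\<^sub>R W n) \<longlonglongrightarrow> 0"
  proof (rule Lim_null_comparison)
    have "(\<lambda>n. \<bar>l n\<bar> * C) \<longlonglongrightarrow> 0 * C"
      by (intro tendsto_mult tendsto_const tendsto_rabs_zero l(2))
    then show "(\<lambda>n. \<bar>l n\<bar> * C) \<longlonglongrightarrow> 0" by simp
    show "\<forall>\<^sub>F n in sequentially. norm (l n *\<^sub>R W n) \<le> \<bar>l n\<bar> * C"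
      unfolding W_def norm_scaleR by (intro always_eventually allI mult_left_mono C) simp
  qed
  ultimately have "convergent (\<lambda>n. \<Sum>i<n. l i *\<^sub>R w i)"
    unfolding abel by (intro convergent_add) (auto simp: summable_iff_convergent convergentI)
  then show ?thesis by (simp add: summable_iff_convergent)
qed

text \<open>The supremum over the tail decreases to \<open>0\<close>; adding \<open>1/(n+1)\<close>
  makes it strictly positive, so that it can serve as a divisor.\<close>

lemma decreasing_null_majorant:
  fixes f :: "nat \<Rightarrow> real"
  assumes f: "f \<longlonglongrightarrow> 0"
  obtains l where "decseq l" "l \<longlonglongrightarrow> 0" "\<And>n. 0 < l n" "\<And>n. f n \<le> l n"
proof -
  have bdd: "bdd_above (f ` {n..})" for n
    using f by (meson Bseq_eq_bounded bdd_above_mono bounded_imp_bdd_above convergentI convergent_imp_Bseq image_mono top_greatest)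
  define s where "s n = max 0 (SUP m\<in>{n..}. f m)" for n
  have dec: "decseq s"
    unfolding s_def by (intro decseq_SucI max.mono order_refl cSUP_subset_mono bdd) auto
  have le: "f n \<le> s n" for n
    unfolding s_def by (intro max.coboundedI2 cSUP_upper bdd) auto
  have lim: "s \<longlonglongrightarrow> 0"
  proof (rule LIMSEQ_I)
    fix r :: real assume "0 < r"
    then obtain N where N: "\<And>n. n \<ge> N \<Longrightarrow> \<bar>f n\<bar> < r / 2"
      using LIMSEQ_D[OF f, of "r / 2"] by auto
    have "norm (s n - 0) < r" if "n \<ge> N" for n
    proof -
      have "(SUP m\<in>{n..}. f m) \<le> r / 2"
      proof (rule cSUP_least)
        fix m assume "m \<in> {n..}"
        then show "f m \<le> r / 2" using N[of m] that by simp
      qed simp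
      then show ?thesis using \<open>0 < r\<close> by (auto simp: s_def)
    qed
    then show "\<exists>N. \<forall>n\<ge>N. norm (s n - 0) < r" by blast
  qed
  show thesis
  proof (rule that[of "\<lambda>n. s n + inverse (real (Suc n))"])
    show "decseq (\<lambda>n. s n + inverse (real (Suc n)))"
      using dec by (intro decseq_SucI add_mono) (auto simp: decseq_Suc_iff field_simps)
    show "(\<lambda>n. s n + inverse (real (Suc n))) \<longlonglongrightarrow> 0"
      using tendsto_add[OF lim LIMSEQ_inverse_real_of_nat] by simp
    show "0 < s n + inverse (real (Suc n))" for n
      by (simp add: s_def add_nonneg_pos)
    show "f n \<le> s n + inverse (real (Suc n))" for n
      using le[of n] by (simp add: add_increasing2)
  qed
qed

lemma null_sequence_sign_summable:
  fixes v :: "nat \<Rightarrow> 'a::euclidean_space"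
  assumes "v \<longlonglongrightarrow> 0"
  obtains \<epsilon> :: "nat \<Rightarrow> real" where "\<And>n. \<epsilon> n \<in> {-1, 1}" and "summable (\<lambda>n. \<epsilon> n *\<^sub>R v n)"
proof -
  obtain l where l: "decseq l" "l \<longlonglongrightarrow> 0" "\<And>n. 0 < l n" "\<And>n. norm (v n) \<le> l n"
    using decreasing_null_majorant[OF tendsto_norm_zero[OF assms]] by blast
  have "norm (v n /\<^sub>R l n) \<le> 1" for n
    using l(3,4)[of n] by (simp add: field_simps)
  then obtain \<epsilon> :: "nat \<Rightarrow> real" where eps: "\<And>n. \<epsilon> n \<in> {-1, 1}"
      "\<And>n. norm (\<Sum>i<n. \<epsilon> i *\<^sub>R (v i /\<^sub>R l i)) \<le> 2 * DIM('a) * (1 :: real)"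
    using signs_with_bounded_partial_sums[of "\<lambda>n. v n /\<^sub>R l n" 1] by blast
  have "summable (\<lambda>i. l i *\<^sub>R \<epsilon> i *\<^sub>R (v i /\<^sub>R l i))"
    using l(1,2) eps(2) by (rule dirichlet_test)
  moreover have "l i *\<^sub>R \<epsilon> i *\<^sub>R (v i /\<^sub>R l i) = \<epsilon> i *\<^sub>R v i" for i
    using l(3)[of i] by simp
  ultimately have "summable (\<lambda>i. \<epsilon> i *\<^sub>R v i)"
    by (simp only:)
  with eps(1) show thesis by (rule that)
qed

section \<open>Greedy steering on the real line\<close>

text \<open>While \<open>y\<close> is far from \<open>0\<close>, each step \<open>t n\<close> brings
  it closer, up to the perturbation; as the steps have infinite sum, \<open>y\<close> must come near
  \<open>0\<close>. From then on small steps cannot carry it away, and the perturbations add at most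
  a small tail.\<close>

lemma greedy_steering_tendsto_0:
  fixes y t p :: "nat \<Rightarrow> real"
  assumes step: "\<And>n. y (Suc n) = y n - (if 0 \<le> y n then 1 else -1) * t n + p n"
    and t: "\<And>n. 0 \<le> t n" "t \<longlonglongrightarrow> 0" "\<not> summable t"
    and p: "summable (\<lambda>n. \<bar>p n\<bar>)"
  shows "y \<longlonglongrightarrow> 0"
proof (rule LIMSEQ_I)
  fix r :: real assume "0 < r"
  define \<eta> where "\<eta> = r / 3"
  have "0 < \<eta>" using \<open>0 < r\<close> by (simp add: \<eta>_def)
  obtain N1 where N1: "\<And>n. n \<ge> N1 \<Longrightarrow> t n < \<eta>"
    using LIMSEQ_D[OF t(2) \<open>0 < \<eta>\<close>] t(1) by auto
  obtain N2 where N2: "\<And>m n. m \<ge> N2 \<Longrightarrow> (\<Sum>i=m..<n. \<bar>p i\<bar>) < \<eta>"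
    using p \<open>0 < \<eta>\<close> unfolding summable_Cauchy
    by (metis abs_ge_self order_le_less_trans real_norm_def)
  define N where "N = max N1 N2"
  \<comment> \<open>Here \<open>t n < \<eta> \<le> \<bar>y n\<bar>\<close>, so the step does not
    overshoot \<open>0\<close>.\<close>
  have far: "\<bar>y (Suc n)\<bar> \<le> \<bar>y n\<bar> - t n + \<bar>p n\<bar>" if "n \<ge> N" "\<eta> \<le> \<bar>y n\<bar>" for n
    using step[of n] N1[of n] t(1)[of n] that by (auto simp: N_def split: if_splits)
  \<comment> \<open>The step may cross \<open>0\<close>, but being shorter than
    \<open>\<eta>\<close> it lands within \<open>\<eta>\<close> on the other side.\<close>
  have near: "\<bar>y (Suc n)\<bar> \<le> \<eta> + \<bar>p n\<bar>" if "n \<ge> N" "\<bar>y n\<bar> \<le> \<eta>" for n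
    using step[of n] N1[of n] t(1)[of n] that by (auto simp: N_def split: if_splits)
  have "\<exists>k\<ge>N. \<bar>y k\<bar> \<le> \<eta>"
  proof (rule ccontr)
    assume "\<not> (\<exists>k\<ge>N. \<bar>y k\<bar> \<le> \<eta>)"
    then have *: "\<eta> \<le> \<bar>y k\<bar>" if "k \<ge> N" for k
      using that by force
    have tele: "\<bar>y (N + n)\<bar> + (\<Sum>i<n. t (N + i)) \<le> \<bar>y N\<bar> + (\<Sum>i<n. \<bar>p (N + i)\<bar>)" for n
    proof (induction n)
      case (Suc n)
      then show ?case using far[of "N + n"] *[of "N + n"] by simp
    qed simp
    have psum: "(\<Sum>i<n. \<bar>p (N + i)\<bar>) \<le> \<eta>" for n
    proof -
      have "(\<Sum>i<n. \<bar>p (N + i)\<bar>) = (\<Sum>i=N..<N+n. \<bar>p i\<bar>)"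
        using sum.atLeastLessThan_shift_0[of "\<lambda>i. \<bar>p i\<bar>" N "N + n"] by (simp add: atLeast0LessThan)
      then show ?thesis using N2[of N "N + n"] by (simp add: N_def)
    qed
    have "summable (\<lambda>i. t (N + i))"
    proof (rule summableI_nonneg_bounded)
      show "(\<Sum>i<n. t (N + i)) \<le> \<bar>y N\<bar> + \<eta>" for n
        using tele[of n] psum[of n] by linarith
    qed (rule t(1))
    then show False
      using t(3) by (simp add: add.commute[of N] summable_iff_shift)
  qed
  then obtain k where k: "k \<ge> N" "\<bar>y k\<bar> \<le> \<eta>" by blast
  have bound: "\<bar>y n\<bar> \<le> \<eta> + (\<Sum>i=k..<n. \<bar>p i\<bar>)" if "k \<le> n" for n
    using that
  proof (induction n rule: dec_induct)
    case base
    then show ?case using k by simp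
  next
    case (step n)
    have "N \<le> n" using step.hyps k(1) by simp
    moreover have "0 \<le> (\<Sum>i=k..<n. \<bar>p i\<bar>)" by (simp add: sum_nonneg)
    \<comment> \<open>If \<open>y n\<close> is far, the bound is carried on; if it is near, the
      bound restarts from \<open>\<eta>\<close>.\<close>
    ultimately have "\<bar>y (Suc n)\<bar> \<le> \<eta> + (\<Sum>i=k..<n. \<bar>p i\<bar>) + \<bar>p n\<bar>"
      using far[of n] near[of n] t(1)[of n] step.IH by linarith
    then show ?case using step.hyps by simp
  qed
  have "norm (y n - 0) < r" if "n \<ge> k" for n
    using bound[OF that] N2[of k n] k(1) \<open>0 < \<eta>\<close> by (auto simp: N_def \<eta>_def)
  then show "\<exists>k. \<forall>n\<ge>k. norm (y n - 0) < r" by blast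
qed

section \<open>Selection of terms close to prescribed directions\<close>

text \<open>Stop as soon as the sum reaches 1: the overshoot is at most the last term, hence at most
  \<open>A\<close>.\<close>

lemma not_summable_obtain_block:
  fixes f :: "nat \<Rightarrow> real"
  assumes f: "\<And>n. 0 \<le> f n" "\<And>n. f n \<le> A" "\<not> summable f"
  shows "\<exists>y>x. 1 \<le> (\<Sum>n=x..<y. f n) \<and> (\<Sum>n=x..<y. f n) \<le> 1 + A"
proof -
  have ex: "\<exists>y. 1 \<le> (\<Sum>n=x..<y. f n)"
  proof (rule ccontr)
    assume "\<nexists>y. 1 \<le> (\<Sum>n=x..<y. f n)"
    then have *: "(\<Sum>n=x..<y. f n) \<le> 1" for y by (meson linear)
    have "summable (\<lambda>i. f (x + i))"
    proof (rule summableI_nonneg_bounded)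
      have "(\<Sum>i<n. f (x + i)) = (\<Sum>i=x..<x+n. f i)" for n
        using sum.atLeastLessThan_shift_0[of f x "x + n"] by (simp add: atLeast0LessThan)
      then show "(\<Sum>i<n. f (x + i)) \<le> 1" for n
        using * by simp
    qed (rule f(1))
    then show False
      using f(3) by (simp add: add.commute[of x] summable_iff_shift)
  qed
  define y where "y = (LEAST y. 1 \<le> (\<Sum>n=x..<y. f n))"
  have y: "1 \<le> (\<Sum>n=x..<y. f n)"
    unfolding y_def using ex by (rule LeastI_ex)
  then have "x < y" by (rule contrapos_pp) simp
  then obtain z where z: "y = Suc z" "x \<le> z"
    by (metis less_imp_Suc_add le_add1)
  have "(\<Sum>n=x..<z. f n) < 1"
    using not_less_Least[of z "\<lambda>y. 1 \<le> (\<Sum>n=x..<y. f n)"] z(1) by (simp add: y_def)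
  then have "(\<Sum>n=x..<y. f n) \<le> 1 + A"
    using f(2)[of z] z by simp
  with y \<open>x < y\<close> show ?thesis by blast
qed

text \<open>\<open>\<kappa> n\<close> is the number of the block containing \<open>n\<close>.
  Selected terms of block \<open>k\<close> deviate by at most a factor \<open>1/2^k\<close> of a
  mass bounded by \<open>1 + A\<close>, which is summable over \<open>k\<close>, while each block
  assigned to \<open>u\<close> contributes at least 1 to the mass of \<open>u\<close>.\<close>

lemma select_terms_near_directions:
  fixes a :: "nat \<Rightarrow> 'a::real_normed_vector" and v :: "nat \<Rightarrow> 'a"
  assumes a: "a \<longlonglongrightarrow> 0"
    and v: "\<And>k e. 0 < e \<Longrightarrow>
      \<not> summable (\<lambda>n. norm (a n) * of_bool (a n /\<^sub>R norm (a n) \<in> ball (v k) e))"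
  obtains I \<kappa> where
    "summable (\<lambda>n. of_bool (n \<in> I) * norm (a n - norm (a n) *\<^sub>R v (\<kappa> n)))"
    "\<And>u. infinite {k. v k = u} \<Longrightarrow>
      \<not> summable (\<lambda>n. norm (a n) * of_bool (n \<in> I \<and> v (\<kappa> n) = u))"
proof -
  define near where "near k n \<longleftrightarrow> a n /\<^sub>R norm (a n) \<in> ball (v k) (1 / 2 ^ k)" for k n
  define g where "g k n = norm (a n) * of_bool (near k n)" for k n
  obtain A where A: "\<And>n. norm (a n) \<le> A"
    using convergent_imp_Bseq[OF convergentI[OF a]] by (auto simp: Bseq_def)
  have g_nonneg: "0 \<le> g k n" for k n by (simp add: g_def)
  have g_le: "g k n \<le> A" for k n
    using A[of n] by (auto simp: g_def intro: order_trans[OF norm_ge_zero])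
  \<comment> \<open>Block \<open>k\<close> is \<open>{m k..<m (Suc k)}\<close>; starting at
    \<open>m 0 = 0\<close> makes the blocks cover all indices.\<close>
  have "\<exists>m. \<forall>k. (k = 0 \<longrightarrow> m k = 0) \<and>
      (m k < m (Suc k) \<and> 1 \<le> (\<Sum>n=m k..<m (Suc k). g k n) \<and> (\<Sum>n=m k..<m (Suc k). g k n) \<le> 1 + A)"
  proof (rule dependent_nat_choice)
    fix x k
    have "\<not> summable (g k)"
      using v[of "1 / 2 ^ k" k] by (simp add: g_def[abs_def] near_def)
    from not_summable_obtain_block[OF g_nonneg g_le this]
    show "\<exists>y. (Suc k = 0 \<longrightarrow> y = 0) \<and>
        (x < y \<and> 1 \<le> (\<Sum>n=x..<y. g k n) \<and> (\<Sum>n=x..<y. g k n) \<le> 1 + A)"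
      by simp
  qed simp
  then obtain m where m: "m 0 = 0" "\<And>k. m k < m (Suc k)"
      "\<And>k. 1 \<le> (\<Sum>n=m k..<m (Suc k). g k n)"
      "\<And>k. (\<Sum>n=m k..<m (Suc k). g k n) \<le> 1 + A"
    by blast
  have mono: "strict_mono m" using m(2) by (simp add: strict_mono_Suc_iff)
  define \<kappa> where "\<kappa> n = (LEAST k. n < m (Suc k))" for n
  have \<kappa>: "\<kappa> n = k" if "n \<in> {m k..<m (Suc k)}" for n k
    unfolding \<kappa>_def
  proof (rule Least_equality)
    show "n < m (Suc k)" using that by simp
    fix j assume "n < m (Suc j)"
    then have "m k < m (Suc j)" using that by simp
    then show "k \<le> j" using mono by (simp add: strict_mono_less)
  qed
  define I where "I = {n. near (\<kappa> n) n}"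
  define e where "e n = of_bool (n \<in> I) * norm (a n - norm (a n) *\<^sub>R v (\<kappa> n))" for n
  have e_le: "e n \<le> g (\<kappa> n) n / 2 ^ \<kappa> n" for n
  proof (cases "n \<in> I \<and> a n \<noteq> 0")
    case True
    \<comment> \<open>Pulling out \<open>norm (a n)\<close> turns the deviation into the distance
      between directions, which \<open>near\<close> bounds.\<close>
    then have "a n - norm (a n) *\<^sub>R v (\<kappa> n) = norm (a n) *\<^sub>R (a n /\<^sub>R norm (a n) - v (\<kappa> n))"
      by (simp add: scaleR_diff_right)
    then have "e n = norm (a n) * norm (a n /\<^sub>R norm (a n) - v (\<kappa> n))"
      using True by (simp add: e_def)
    also have "\<dots> \<le> norm (a n) * (1 / 2 ^ \<kappa> n)"
      using True by (intro mult_left_mono) (auto simp: I_def near_def dist_norm norm_minus_commute)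
    finally show ?thesis using True by (simp add: g_def I_def)
  qed (auto simp: e_def g_def)
  have block: "(\<Sum>n<m K. e n) \<le> (\<Sum>k<K. (1 + A) * (1 / 2) ^ k)" for K
  proof (induction K)
    case (Suc K)
    have "(\<Sum>n=m K..<m (Suc K). e n) \<le> (\<Sum>n=m K..<m (Suc K). g K n / 2 ^ K)"
      using e_le \<kappa> by (intro sum_mono) metis
    also have "\<dots> \<le> (1 + A) * (1 / 2) ^ K"
      using m(4)[of K] by (simp add: sum_divide_distrib[symmetric] power_divide divide_right_mono)
    finally have "(\<Sum>n=m K..<m (Suc K). e n) \<le> (1 + A) * (1 / 2) ^ K" .
    moreover have "(\<Sum>n<m (Suc K). e n) = (\<Sum>n<m K. e n) + (\<Sum>n=m K..<m (Suc K). e n)"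
      using m(2)[of K] by (simp add: lessThan_atLeast0 sum.atLeastLessThan_concat)
    ultimately show ?case using Suc by simp
  qed (simp add: m(1))
  have "0 \<le> A" using A[of 0] norm_ge_zero order_trans by blast
  have "summable e"
  proof (rule summableI_nonneg_bounded)
    show "0 \<le> e n" for n by (simp add: e_def)
    fix n
    have "(\<Sum>i<n. e i) \<le> (\<Sum>i<m n. e i)"
      using strict_mono_imp_increasing[OF mono, of n] by (intro sum_mono2) (auto simp: e_def)
    also have "\<dots> \<le> (\<Sum>k<n. (1 + A) * (1 / 2) ^ k)" by (rule block)
    also have "\<dots> \<le> (\<Sum>k. (1 + A) * (1 / 2) ^ k)"
      using \<open>0 \<le> A\<close> by (intro sum_le_suminf summable_mult summable_geometric) auto
    finally show "(\<Sum>i<n. e i) \<le> (\<Sum>k. (1 + A) * (1 / 2) ^ k)" .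
  qed
  moreover have "\<not> summable (\<lambda>n. norm (a n) * of_bool (n \<in> I \<and> v (\<kappa> n) = u))" (is "\<not> summable ?h")
    if inf: "infinite {k. v k = u}" for u
  proof
    assume "summable ?h"
    \<comment> \<open>By the Cauchy criterion late blocks would have sum below 1, yet blocks
      assigned to \<open>u\<close> occur arbitrarily late.\<close>
    then obtain N where N: "\<And>i j. i \<ge> N \<Longrightarrow> norm (\<Sum>n=i..<j. ?h n) < 1"
      unfolding summable_Cauchy by (meson zero_less_one)
    obtain k where k: "k \<ge> N" "v k = u"
      using inf unfolding infinite_nat_iff_unbounded_le by auto
    have "(\<Sum>n=m k..<m (Suc k). ?h n) = (\<Sum>n=m k..<m (Suc k). g k n)"
      using \<kappa>[of _ k] k(2) by (intro sum.cong) (auto simp: g_def I_def)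
    moreover have "m k \<ge> N"
      using strict_mono_imp_increasing[OF mono, of k] k(1) by simp
    ultimately show False
      using N[of "m k" "m (Suc k)"] m(3)[of k] by simp
  qed
  ultimately show thesis
    using that[of I \<kappa>] by (simp add: e_def[abs_def])
qed

section \<open>Greedy steering in the coordinates of a basis\<close>

text \<open>Up to summable errors, a selected term moves only the coordinate of the residual along
  its own basis vector \<open>w n\<close>. Hence every coordinate separately follows the
  one-dimensional greedy rule.\<close>

lemma steering_sign_sums:
  fixes a :: "nat \<Rightarrow> 'a::euclidean_space" and w :: "nat \<Rightarrow> 'a"
  assumes a: "a \<longlonglongrightarrow> 0" and U: "independent U" "span U = UNIV" and w: "\<And>n. w n \<in> U"
    and err: "summable (\<lambda>n. of_bool (n \<in> I) * norm (a n - norm (a n) *\<^sub>R w n))"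
    and mass: "\<And>u. u \<in> U \<Longrightarrow> \<not> summable (\<lambda>n. norm (a n) * of_bool (n \<in> I \<and> w n = u))"
  obtains \<epsilon> :: "nat \<Rightarrow> real" where "\<And>n. \<epsilon> n \<in> {-1, 1}"
    and "(\<lambda>n. \<epsilon> n *\<^sub>R (if n \<in> I then a n else 0)) sums x"
proof -
  define b where "b n = (if n \<in> I then a n else 0)" for n
  define \<phi> where "\<phi> u z = representation U z u" for u z
  have lin: "linear (\<phi> u)" for u
    by (rule linearI) (use U in \<open>simp_all add: \<phi>_def real_vector.representation_add real_vector.representation_scale\<close>)
  have \<phi>_basis: "\<phi> u z = of_bool (z = u)" if "z \<in> U" for u z
    using real_vector.representation_basis[OF U(1) that] by (auto simp: \<phi>_def)
  have fin: "finite U" using U(1) by (rule independent_imp_finite)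
  have expand: "(\<Sum>u\<in>U. \<phi> u z *\<^sub>R u) = z" for z
    unfolding \<phi>_def by (rule real_vector.sum_representation_eq) (use U fin in auto)
  define sg where "sg n r = (if 0 \<le> \<phi> (w n) r then 1 else -1 :: real)" for n r
  \<comment> \<open>The residual and the signs are defined together, since each sign depends on the
    residual reached so far. Outside \<open>I\<close> the residual stands still.\<close>
  define y where "y = rec_nat x (\<lambda>n r. r - sg n r *\<^sub>R b n)"
  define \<epsilon> where "\<epsilon> n = sg n (y n)" for n
  have y: "y 0 = x" "y (Suc n) = y n - \<epsilon> n *\<^sub>R b n" for n
    by (simp_all add: y_def \<epsilon>_def)
  have residual: "y n = x - (\<Sum>i<n. \<epsilon> i *\<^sub>R b i)" for n
    by (induction n) (simp_all add: y)
  have coord: "(\<lambda>n. \<phi> u (y n)) \<longlonglongrightarrow> 0" if u: "u \<in> U" for u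
  proof -
    define t where "t n = norm (a n) * of_bool (n \<in> I \<and> w n = u)" for n
    \<comment> \<open>The perturbation collects errors of all selected terms, since the deviation of
      a term assigned to another vector may also have a component along \<open>u\<close>.\<close>
    define p where "p n = - \<epsilon> n * (of_bool (n \<in> I) * \<phi> u (a n - norm (a n) *\<^sub>R w n))" for n
    show ?thesis
    proof (rule greedy_steering_tendsto_0)
      fix n
      have "\<phi> u (b n) = t n + of_bool (n \<in> I) * \<phi> u (a n - norm (a n) *\<^sub>R w n)"
        using w[of n]
        by (auto simp: b_def t_def linear_0[OF lin] linear_diff[OF lin] linear_scale[OF lin] \<phi>_basis)
      then have "\<phi> u (y (Suc n)) = \<phi> u (y n) - \<epsilon> n * t n + p n"
        by (simp add: y linear_diff[OF lin, of u "y n"] linear_scale[OF lin, of u _ "b n"] p_def distrib_left)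
      \<comment> \<open>The sign looks at the coordinate along \<open>w n\<close>; this is the one
        along \<open>u\<close> whenever \<open>t n \<noteq> 0\<close>.\<close>
      moreover have "\<epsilon> n * t n = (if 0 \<le> \<phi> u (y n) then 1 else -1) * t n"
        by (auto simp: \<epsilon>_def sg_def t_def)
      ultimately show "\<phi> u (y (Suc n)) = \<phi> u (y n) - (if 0 \<le> \<phi> u (y n) then 1 else -1) * t n + p n"
        by simp
    next
      show "0 \<le> t n" for n by (simp add: t_def)
    next
      show "t \<longlonglongrightarrow> 0"
      proof (rule Lim_null_comparison)
        show "\<forall>\<^sub>F n in sequentially. norm (t n) \<le> norm (a n)"
          by (simp add: t_def)
      qed (use a in \<open>rule tendsto_norm_zero\<close>)
    next
      show "\<not> summable t" using mass[OF u] by (simp add: t_def[abs_def])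
    next
      obtain K where K: "\<And>z. norm (\<phi> u z) \<le> norm z * K"
        using linear_conv_bounded_linear[THEN iffD1, OF lin] by (meson bounded_linear.bounded)
      show "summable (\<lambda>n. \<bar>p n\<bar>)"
      proof (rule summable_comparison_test')
        show "summable (\<lambda>n. of_bool (n \<in> I) * norm (a n - norm (a n) *\<^sub>R w n) * K)"
          using err by (rule summable_mult2)
        show "norm \<bar>p n\<bar> \<le> of_bool (n \<in> I) * norm (a n - norm (a n) *\<^sub>R w n) * K" for n
          using K[of "a n - norm (a n) *\<^sub>R w n"] by (auto simp: p_def abs_mult \<epsilon>_def sg_def)
      qed
    qed
  qed
  have "(\<lambda>n. \<Sum>u\<in>U. \<phi> u (y n) *\<^sub>R u) \<longlonglongrightarrow> (\<Sum>u\<in>U. 0 *\<^sub>R u)"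
    by (intro tendsto_sum tendsto_scaleR tendsto_const coord)
  then have "y \<longlonglongrightarrow> 0" by (simp add: expand)
  then have "(\<lambda>n. x - y n) \<longlonglongrightarrow> x - 0" by (intro tendsto_diff tendsto_const)
  then have "(\<lambda>n. \<epsilon> n *\<^sub>R b n) sums x" by (simp add: sums_def residual)
  then show thesis
    using that[of \<epsilon>] by (simp add: b_def \<epsilon>_def sg_def)
qed

section \<open>Merging the selected and the remaining terms\<close>

theorem theorem1p4:
  fixes a :: "nat \<Rightarrow> real ^ 'd" and U :: "(real ^ 'd) set"
  assumes "(\<lambda>n. norm (a n)) \<longlonglongrightarrow> 0"
    and "card U = CARD('d)"
    and "independent U"
    and "\<forall>u\<in>U. levy_vector a u"
  shows "sign_sums a = UNIV"
proof -
  have a: "a \<longlonglongrightarrow> 0" using assms(1) by (rule tendsto_norm_zero_cancel)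
  have finU: "finite U" using assms(3) by (rule independent_imp_finite)
  have "U \<noteq> {}" using assms(2) by auto
  have spanU: "span U = UNIV"
    using card_eq_dim[of U UNIV] assms(2,3) finU by auto
  have levy: "\<not> summable (\<lambda>n. norm (a n) * of_bool (a n /\<^sub>R norm (a n) \<in> ball u e))"
    if "u \<in> U" "0 < e" for u e
  proof
    assume "summable (\<lambda>n. norm (a n) * of_bool (a n /\<^sub>R norm (a n) \<in> ball u e))"
    then have "(\<Sum>n. ennreal (norm (a n) * of_bool (a n /\<^sub>R norm (a n) \<in> ball u e))) \<noteq> top"
      by (rule ennreal_suminf_neq_top) simp
    moreover have "(\<Sum>n. ennreal (norm (a n) * of_bool (a n /\<^sub>R norm (a n) \<in> ball u e))) = \<infinity>"
      using assms(4) that unfolding levy_vector_def by blast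
    ultimately show False unfolding infinity_ennreal_def by (rule notE)
  qed
  \<comment> \<open>The first component of \<open>prod_decode\<close> takes each value infinitely
    often, so every vector of \<open>U\<close> recurs infinitely often.\<close>
  define v where "v k = from_nat_into U (fst (prod_decode k))" for k
  have v: "v k \<in> U" for k
    using \<open>U \<noteq> {}\<close> by (simp add: v_def from_nat_into)
  have v_inf: "infinite {k. v k = u}" if u: "u \<in> U" for u
  proof -
    obtain j where j: "from_nat_into U j = u"
      using from_nat_into_surj[OF countable_finite[OF finU] u] by blast
    have "infinite (range (\<lambda>i. prod_encode (j, i)))"
      by (intro range_inj_infinite injI) simp
    then show ?thesis
      by (rule infinite_super[rotated]) (auto simp: v_def j)
  qed
  obtain I \<kappa> where err: "summable (\<lambda>n. of_bool (n \<in> I) * norm (a n - norm (a n) *\<^sub>R v (\<kappa> n)))"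
    and mass: "\<And>u. infinite {k. v k = u} \<Longrightarrow>
      \<not> summable (\<lambda>n. norm (a n) * of_bool (n \<in> I \<and> v (\<kappa> n) = u))"
    using select_terms_near_directions[of a v, OF a levy[OF v]] by blast
  define r where "r n = (if n \<in> I then 0 else a n)" for n
  have "r \<longlonglongrightarrow> 0"
    by (rule Lim_null_comparison[OF _ assms(1)]) (simp add: r_def)
  then obtain \<delta> where \<delta>: "\<And>n. \<delta> n \<in> {-1, 1}" "summable (\<lambda>n. \<delta> n *\<^sub>R r n)"
    using null_sequence_sign_summable by blast
  have "x \<in> sign_sums a" for x
  proof -
    \<comment> \<open>The signs \<open>\<delta>\<close> do not depend on \<open>x\<close>; the
      selected terms are steered to what the remaining series leaves of \<open>x\<close>.\<close>
    obtain \<gamma> where \<gamma>: "\<And>n. \<gamma> n \<in> {-1, 1}"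
      "(\<lambda>n. \<gamma> n *\<^sub>R (if n \<in> I then a n else 0)) sums (x - (\<Sum>n. \<delta> n *\<^sub>R r n))"
      using steering_sign_sums[OF a assms(3) spanU v err mass[OF v_inf]] by blast
    define \<epsilon> where "\<epsilon> n = (if n \<in> I then \<gamma> n else \<delta> n)" for n
    \<comment> \<open>Both series keep the original indices and have zeros in the other's places, so
      adding them termwise preserves the order of summation.\<close>
    have "(\<lambda>n. \<gamma> n *\<^sub>R (if n \<in> I then a n else 0) + \<delta> n *\<^sub>R r n) sums x"
      using sums_add[OF \<gamma>(2) summable_sums[OF \<delta>(2)]] by simp
    moreover have "\<gamma> n *\<^sub>R (if n \<in> I then a n else 0) + \<delta> n *\<^sub>R r n = \<epsilon> n *\<^sub>R a n" for n
      by (simp add: \<epsilon>_def r_def)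
    moreover have "\<epsilon> n \<in> {-1, 1}" for n
      using \<gamma>(1)[of n] \<delta>(1)[of n] by (simp add: \<epsilon>_def)
    ultimately show ?thesis
      unfolding sign_sums_def by auto
  qed
  then show ?thesis by blast
qed

end
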